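(* Let $K$ be a finite simplicial complex with vertex set $V$, $|V|=n$, let $f\colon V\to\{1,\dots,n\}$ be an order function (a bijection), and let $F_f$ be the colex vector field induced by $f$. Let $\sigma_1,\dots,\sigma_N$ be all simplices of $K$ listed in colex order with respect to $f$, and $K^i=\{\sigma_j\mid j\le i\}$. Let $T=\{i\in\{1,\dots,N-1\}\mid\{\sigma_i\to\sigma_{i+1}\}\in F_f\}$ and let $J=\{1,\dots,N\}\setminus T=\{j_1<j_2<\dots<j_{N-|T|}\}$ be the set of non-tail indices. Consider the filtration $$\mathcal{K}'=\{\emptyset=K^0\subset K^{j_1}\subset K^{j_2}\subset\cdots\subset K^{j_{N-|T|}}=K^N=K\}.$$ For each $j\in J$ let $F_f^j$ be the restriction of $F_f$ to $K^j$, i.e. $\{\alpha\to\beta\}\in F_f^j$ if and only if $\alpha,\beta\in K^j$ and $\{\alpha\to\beta\}\in F_f$. Then $\mathcal{F}=\{F_f^j\mid j\in J\}$ is a filtered acyclic vector field of $\mathcal{K}'$.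
   Context: Simplices are nonempty finite subsets of $V$; $K$ is closed under taking nonempty subsets. For $\sigma\in K$, $V_\sigma=\{v\in V\mid\{v\}\cup\sigma\in K\}$ and the candidate vertex is $c_f(\sigma)=\operatorname{argmin}_{v\in V_\sigma}f(v)$. The colex vector field $F_f$ is the collection of pairs (arrows) $\{\alpha\to\beta\}$ of simplices of $K$ of dimensions $p$ and $p+1$ (any $p\ge0$) such that $\beta=\{c_f(\alpha)\}\cup\alpha$ and $c_f(\alpha)\notin\alpha$. It is known that $F_f$ is a discrete vector field, and that each of its arrows is of the form $\{\sigma_i\to\sigma_{i+1}\}$ in the colex listing. Colex order: view each simplex as the word of its vertices listed in increasing order of $f$. For distinct words $a=a_0\cdots a_k$ and $b=b_0\cdots b_\ell$, let $J_0$ be the smallest $i\in\{0,\dots,\min\{k,\ell\}\}$ with $a_{k-i}\ne b_{\ell-i}$. If it exists, $a<^{\mathrm{co}}b$ iff $f(a_{k-J_0})<f(b_{\ell-J_0})$; otherwise $a<^{\mathrm{co}}b$ iff $k<\ell$. A discrete vector field on a complex is a collection of pairs (arrows) $\{\alpha^{(p)}\to\beta^{(p+1)}\}$ with $\alpha$ a codimension-1 face of $\beta$ and no simplex in more than one pair; $\alpha$ is the tail and $\beta$ the head of the arrow; a simplex in no arrow is critical. An $F$-path is a sequence $\alpha_0^{(p)},\beta_0^{(p+1)},\dots,\beta_r^{(p+1)},\alpha_{r+1}^{(p)}$ with $\{\alpha_i\to\beta_i\}\in F$, $\alpha_{i+1}<\beta_i$ (proper face), $\alpha_i\neq\alpha_{i+1}$;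 nontrivial if $r\ge0$, closed if $\alpha_0=\alpha_{r+1}$. $F$ is acyclic if it has no nontrivial closed $F$-paths. Filtered acyclic vector field: given a filtration $\{K_1\subset K_2\subset\dots\subset K_M\}$ of a complex, a filtered acyclic vector field of it is a collection of acyclic discrete vector fields $F^m$, one on each $K_m$, such that for all $m\in\{1,\dots,M-1\}$: (i) for all $\sigma\in K_m$, if $\sigma$ is a tail, a head, or critical in $F^m$, then it is respectively a tail, a head, or critical in $F^{m+1}$; (ii) if $\{\alpha\to\beta\}\in F^{m+1}$ and $\alpha,\beta\in K_m$, then $\{\alpha\to\beta\}\in F^m$. Here this is applied to the nonempty frames $K_m=K^{j_m}$, with $F^m=F_f^{j_m}$. *)

theory Defs
  imports Main
begin

text \<open>\<open>V\<close> is the ambient vertex set. A member of \<open>V\<close> need not span a 0-simplex, so that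
  subcomplexes are complexes on the same \<open>V\<close>.\<close>

definition simplicial_complex :: "'a set \<Rightarrow> 'a set set \<Rightarrow> bool" where
  "simplicial_complex V K \<longleftrightarrow>
     (\<forall>\<sigma>\<in>K. \<sigma> \<noteq> {} \<and> finite \<sigma> \<and> \<sigma> \<subseteq> V) \<and>
     (\<forall>\<sigma>\<in>K. \<forall>\<tau>. \<tau> \<noteq> {} \<and> \<tau> \<subseteq> \<sigma> \<longrightarrow> \<tau> \<in> K)"

definition simplex_dim :: "'a set \<Rightarrow> nat" where
  "simplex_dim \<sigma> = card \<sigma> - 1"

section \<open>Discrete vector fields\<close>

text \<open>An arrow with tail \<open>\<alpha>\<close> and head \<open>\<beta>\<close> is the pair \<open>(\<alpha>, \<beta>)\<close>.\<close>

type_synonym 'a arrows = "('a set \<times> 'a set) set"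

definition discrete_vf :: "'a set set \<Rightarrow> 'a arrows \<Rightarrow> bool" where
  "discrete_vf K F \<longleftrightarrow>
     (\<forall>(\<alpha>, \<beta>)\<in>F. \<alpha> \<in> K \<and> \<beta> \<in> K \<and> \<alpha> \<subset> \<beta> \<and> simplex_dim \<beta> = simplex_dim \<alpha> + 1) \<and>
     (\<forall>(\<alpha>, \<beta>)\<in>F. \<forall>(\<alpha>', \<beta>')\<in>F. {\<alpha>, \<beta>} \<inter> {\<alpha>', \<beta>'} \<noteq> {} \<longrightarrow> (\<alpha>, \<beta>) = (\<alpha>', \<beta>'))"

definition is_tail :: "'a arrows \<Rightarrow> 'a set \<Rightarrow> bool" where
  "is_tail F \<sigma> \<longleftrightarrow> (\<exists>\<beta>. (\<sigma>, \<beta>) \<in> F)"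

definition is_head :: "'a arrows \<Rightarrow> 'a set \<Rightarrow> bool" where
  "is_head F \<sigma> \<longleftrightarrow> (\<exists>\<alpha>. (\<alpha>, \<sigma>) \<in> F)"

definition is_critical :: "'a set set \<Rightarrow> 'a arrows \<Rightarrow> 'a set \<Rightarrow> bool" where
  "is_critical K F \<sigma> \<longleftrightarrow> \<sigma> \<in> K \<and> \<not> is_tail F \<sigma> \<and> \<not> is_head F \<sigma>"

text \<open>The nontrivial paths \<open>\<alpha> 0, \<beta> 0, \<dots>, \<beta> r, \<alpha> (r + 1)\<close>; since \<open>r\<close> is a natural number, the
  trivial path consisting of \<open>\<alpha> 0\<close> alone is excluded.\<close>

definition nontrivial_path ::
    "'a set set \<Rightarrow> 'a arrows \<Rightarrow> nat \<Rightarrow> (nat \<Rightarrow> 'a set) \<Rightarrow> (nat \<Rightarrow> 'a set) \<Rightarrow> bool" where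
  "nontrivial_path K F r \<alpha> \<beta> \<longleftrightarrow>
     (\<exists>p. (\<forall>i\<le>r + 1. \<alpha> i \<in> K \<and> simplex_dim (\<alpha> i) = p) \<and>
          (\<forall>i\<le>r. \<beta> i \<in> K \<and> simplex_dim (\<beta> i) = p + 1)) \<and>
     (\<forall>i\<le>r. (\<alpha> i, \<beta> i) \<in> F \<and> \<alpha> (i + 1) \<subset> \<beta> i \<and> \<alpha> i \<noteq> \<alpha> (i + 1))"

definition acyclic_vf :: "'a set set \<Rightarrow> 'a arrows \<Rightarrow> bool" where
  "acyclic_vf K F \<longleftrightarrow> discrete_vf K F \<and>
     \<not> (\<exists>r \<alpha> \<beta>. nontrivial_path K F r \<alpha> \<beta> \<and> \<alpha> 0 = \<alpha> (r + 1))"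

section \<open>Filtrations and filtered acyclic vector fields\<close>

text \<open>The filtration \<open>{} = L 0 \<subset> L 1 \<subset> \<dots> \<subset> L M = K\<close> of \<open>K\<close> by subcomplexes; the
  vector fields below live on the nonempty frames \<open>L 1, \<dots>, L M\<close>.\<close>

definition filtration :: "'a set \<Rightarrow> 'a set set \<Rightarrow> nat \<Rightarrow> (nat \<Rightarrow> 'a set set) \<Rightarrow> bool" where
  "filtration V K M L \<longleftrightarrow> L 0 = {} \<and> L M = K \<and>
     (\<forall>m\<in>{0..M}. simplicial_complex V (L m)) \<and> (\<forall>m<M. L m \<subset> L (m + 1))"

definition filtered_acyclic_vf ::
    "'a set \<Rightarrow> 'a set set \<Rightarrow> nat \<Rightarrow> (nat \<Rightarrow> 'a set set) \<Rightarrow> (nat \<Rightarrow> 'a arrows) \<Rightarrow> bool" where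
  "filtered_acyclic_vf V K M L F \<longleftrightarrow> filtration V K M L \<and>
     (\<forall>m\<in>{1..M}. acyclic_vf (L m) (F m)) \<and>
     (\<forall>m\<in>{1..M - 1}.
        (\<forall>\<sigma>\<in>L m. (is_tail (F m) \<sigma> \<longrightarrow> is_tail (F (m + 1)) \<sigma>) \<and>
                 (is_head (F m) \<sigma> \<longrightarrow> is_head (F (m + 1)) \<sigma>) \<and>
                 (is_critical (L m) (F m) \<sigma> \<longrightarrow> is_critical (L (m + 1)) (F (m + 1)) \<sigma>)) \<and>
        (\<forall>\<alpha> \<beta>. (\<alpha>, \<beta>) \<in> F (m + 1) \<and> \<alpha> \<in> L m \<and> \<beta> \<in> L m \<longrightarrow> (\<alpha>, \<beta>) \<in> F m))"

section \<open>Colex order and colex vector field\<close>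

definition word :: "('a \<Rightarrow> nat) \<Rightarrow> 'a set \<Rightarrow> 'a list" where
  "word f \<sigma> = sorted_key_list_of_set f \<sigma>"

text \<open>For nonempty words; \<open>D\<close> is the set of positions, counted from the right end, at which the
  words differ, so the smallest such position is \<open>Min D\<close>.\<close>

definition colex_less_word :: "('a \<Rightarrow> nat) \<Rightarrow> 'a list \<Rightarrow> 'a list \<Rightarrow> bool" where
  "colex_less_word f a b \<longleftrightarrow> a \<noteq> b \<and>
     (let k = length a - 1; l = length b - 1;
          D = {i \<in> {0..min k l}. a ! (k - i) \<noteq> b ! (l - i)}
      in if D \<noteq> {} then f (a ! (k - Min D)) < f (b ! (l - Min D)) else k < l)"

definition colex_less :: "('a \<Rightarrow> nat) \<Rightarrow> 'a set \<Rightarrow> 'a set \<Rightarrow> bool" where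
  "colex_less f \<sigma> \<tau> \<longleftrightarrow> colex_less_word f (word f \<sigma>) (word f \<tau>)"

text \<open>The listing is indexed from 1; \<open>\<sigma> i\<close> is irrelevant for \<open>i\<close> outside \<open>{1..N}\<close>.\<close>

definition colex_listing ::
    "('a \<Rightarrow> nat) \<Rightarrow> 'a set set \<Rightarrow> nat \<Rightarrow> (nat \<Rightarrow> 'a set) \<Rightarrow> bool" where
  "colex_listing f K N \<sigma> \<longleftrightarrow> bij_betw \<sigma> {1..N} K \<and>
     (\<forall>i\<in>{1..N}. \<forall>j\<in>{1..N}. i < j \<longrightarrow> colex_less f (\<sigma> i) (\<sigma> j))"

definition joinable :: "'a set \<Rightarrow> 'a set set \<Rightarrow> 'a set \<Rightarrow> 'a set" where
  "joinable V K \<sigma> = {v \<in> V. {v} \<union> \<sigma> \<in> K}"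

definition candidate :: "'a set \<Rightarrow> 'a set set \<Rightarrow> ('a \<Rightarrow> nat) \<Rightarrow> 'a set \<Rightarrow> 'a" where
  "candidate V K f \<sigma> = arg_min_on f (joinable V K \<sigma>)"

definition colex_vf :: "'a set \<Rightarrow> 'a set set \<Rightarrow> ('a \<Rightarrow> nat) \<Rightarrow> 'a arrows" where
  "colex_vf V K f = {(\<alpha>, \<beta>). \<alpha> \<in> K \<and> \<beta> \<in> K \<and> simplex_dim \<beta> = simplex_dim \<alpha> + 1 \<and>
     \<beta> = {candidate V K f \<alpha>} \<union> \<alpha> \<and> candidate V K f \<alpha> \<notin> \<alpha>}"

definition restrict_vf :: "'a arrows \<Rightarrow> 'a set set \<Rightarrow> 'a arrows" where
  "restrict_vf F L = {(\<alpha>, \<beta>). \<alpha> \<in> L \<and> \<beta> \<in> L \<and> (\<alpha>, \<beta>) \<in> F}"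

end

theory Submission
  imports Defs
begin

text \<open>Encode a simplex \<open>\<sigma>\<close> by the binary number \<open>w \<sigma> = (\<Sum>v\<in>\<sigma>. 2 ^ f v)\<close>; colex order is the order of
  these numbers. An arrow adds to its tail \<open>\<alpha>\<close> a new smallest vertex \<open>c\<close>, so the next simplex
  of a path drops a vertex larger than \<open>c\<close> and has smaller \<open>w\<close>: there are no closed paths.
  A simplex strictly between \<open>\<alpha>\<close> and \<open>{c} \<union> \<alpha>\<close> would contain \<open>{v} \<union> \<alpha>\<close> for some \<open>v\<close> smaller
  than \<open>c\<close>, contradicting the minimality of \<open>c\<close>; so tail and head are consecutive, and cutting the
  listing at a non-tail index never separates them.\<close>

section \<open>Binary weights and colex order\<close>

definition weight :: "('a \<Rightarrow> nat) \<Rightarrow> 'a set \<Rightarrow> nat" where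
  "weight f A = (\<Sum>v\<in>A. 2 ^ f v)"

text \<open>By injectivity the exponents are distinct and below \<open>k\<close>, so the sum is at
  most \<open>2 ^ k - 1\<close>.\<close>

lemma weight_less_power:
  assumes "finite A" "inj_on f A" "\<And>x. x \<in> A \<Longrightarrow> f x < k"
  shows "weight f A < 2 ^ k"
proof -
  have "weight f A = (\<Sum>i\<in>f ` A. 2 ^ i)"
    unfolding weight_def using assms(2) by (simp add: sum.reindex)
  also have "\<dots> \<le> (\<Sum>i\<in>{0..<k}. 2 ^ i)"
    using assms(3) by (intro sum_mono2) auto
  also have "\<dots> < (2 ^ k :: nat)"
    by (induction k) auto
  finally show ?thesis .
qed

lemma weight_subset_mono: "finite B \<Longrightarrow> A \<subseteq> B \<Longrightarrow> weight f A \<le> weight f B"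
  unfolding weight_def by (rule sum_mono2) auto

text \<open>The common part cancels, and \<open>A - B\<close> weighs less than
  \<open>2 ^ f m\<close>, a single summand of the weight of \<open>B - A\<close>.\<close>

lemma weight_less:
  assumes "finite A" "finite B" "inj_on f A" "m \<in> B - A"
    and less: "\<And>x. x \<in> A - B \<Longrightarrow> f x < f m"
  shows "weight f A < weight f B"
proof -
  have "weight f A = weight f (A \<inter> B) + weight f (A - B)"
    unfolding weight_def using assms(1) by (simp add: sum.Int_Diff)
  also have "weight f (A - B) < 2 ^ f m"
    using assms by (intro weight_less_power) (auto intro: inj_on_subset)
  also have "2 ^ f m \<le> weight f (B - A)"
    unfolding weight_def using assms by (intro member_le_sum) auto
  also have "weight f (A \<inter> B) + weight f (B - A) = weight f B"
    unfolding weight_def using assms(2) by (simp add: sum.Int_Diff[of B _ A] Int_commute)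
  finally show ?thesis by simp
qed

lemma weight_psubset: "finite B \<Longrightarrow> A \<subset> B \<Longrightarrow> weight f A < weight f B"
  unfolding weight_def
  by (blast dest: psubset_imp_ex_mem
      intro: sum_strict_mono2[of B A _ "\<lambda>v. 2 ^ f v"] zero_less_power zero_less_numeral)

lemma word_props:
  fixes f :: "'a \<Rightarrow> nat"
  assumes "finite A" "inj_on f A"
  shows "set (word f A) = A" "sorted_wrt (<) (map f (word f A))"
proof -
  \<comment> \<open>The locale speaks of the constant parametrised by an order; the rewrites clause
    replaces it by the type class constant used in \<open>word\<close>.\<close>
  interpret folding_insort_key "(\<le>)" "(<)" A f
    rewrites "linorder.sorted_key_list_of_set (\<le>) = (sorted_key_list_of_set :: ('a \<Rightarrow> nat) \<Rightarrow> _)"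
  proof -
    show "folding_insort_key (\<le>) (<) A f" by standard (rule assms(2))
    show "linorder.sorted_key_list_of_set (\<le>) = (sorted_key_list_of_set :: ('a \<Rightarrow> nat) \<Rightarrow> _)"
      by (simp only: sorted_key_list_of_set_def[abs_def] insort_key_def
          linorder.sorted_key_list_of_set_def[OF linorder_class.linorder_axioms, abs_def]
          linorder.insort_key_def[OF linorder_class.linorder_axioms])
  qed
  show "set (word f A) = A" "sorted_wrt (<) (map f (word f A))"
    using assms(1) by (simp_all add: word_def)
qed

text \<open>Words increase in \<open>f\<close>, so reading from the right starts at the largest
  vertex. Either \<open>a\<close> is a proper suffix of \<open>b\<close> and \<open>A\<close> a
  proper subset of \<open>B\<close>, or the vertex of \<open>b\<close> at the first difference from
  the right dominates \<open>A - B\<close>.\<close>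

lemma colex_less_imp_weight_less:
  assumes "colex_less f A B" "finite A" "finite B" "A \<noteq> {}" "B \<noteq> {}"
    and injA: "inj_on f A" and injB: "inj_on f B"
  shows "weight f A < weight f B"
proof -
  define a b where "a = word f A" and "b = word f B"
  define k l where "k = length a - 1" and "l = length b - 1"
  define D where "D = {i \<in> {0..min k l}. a ! (k - i) \<noteq> b ! (l - i)}"
  have a: "set a = A" "sorted_wrt (<) (map f a)" and b: "set b = B" "sorted_wrt (<) (map f b)"
    using word_props[OF \<open>finite A\<close> injA] word_props[OF \<open>finite B\<close> injB]
    by (simp_all add: a_def b_def)
  \<comment> \<open>Nonemptiness matters: truncated subtraction would give \<open>k = 0\<close> for
    the empty word too.\<close>
  have len: "length a = Suc k" "length b = Suc l"
    using a(1) b(1) assms(4,5) by (cases a; cases b; force simp: k_def l_def)+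
  have a_mono: "f (a ! p) < f (a ! q)" if "p < q" "q \<le> k" for p q
    using sorted_wrt_nth_less[OF a(2), of p q] that len by simp
  have b_mono: "f (b ! p) < f (b ! q)" if "p < q" "q \<le> l" for p q
    using sorted_wrt_nth_less[OF b(2), of p q] that len by simp
  have co: "if D \<noteq> {} then f (a ! (k - Min D)) < f (b ! (l - Min D)) else k < l"
    using assms(1) unfolding colex_less_def colex_less_word_def Let_def
    by (fold a_def b_def, fold k_def l_def, fold D_def) blast
  show ?thesis
  proof (cases "D = {}")
    case True
    with co have kl: "k < l" by simp
    have "A \<subseteq> B"
    proof
      fix x assume "x \<in> A"
      then obtain p where p: "p \<le> k" "x = a ! p"
        using a(1) len by (metis in_set_conv_nth less_Suc_eq_le)
      have "k - p \<notin> D" using True by simp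
      hence "x = b ! (l - (k - p))" using p kl by (simp add: D_def)
      thus "x \<in> B" using b(1) len kl by (metis diff_le_self le_imp_less_Suc nth_mem)
    qed
    moreover have "A \<noteq> B"
      using kl len by (auto simp: a_def b_def)
    ultimately show ?thesis using assms(3) by (intro weight_psubset) auto
  next
    case False
    define d where "d = Min D"
    have less: "f (a ! (k - d)) < f (b ! (l - d))" using co False by (simp add: d_def)
    have finD: "finite D" by (simp add: D_def)
    hence "d \<in> D" using False by (simp add: d_def)
    hence d: "d \<le> k" "d \<le> l" by (auto simp: D_def)
    have eq: "a ! p = b ! (l - (k - p))" if "k - d < p" "p \<le> k" for p
    proof -
      have "k - p \<notin> D" using finD that d unfolding d_def by (auto dest: Min_le)
      thus ?thesis using that d by (auto simp: D_def)
    qed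
    have low: "f (a ! p) < f (b ! (l - d))" if "p \<le> k - d" for p
      using a_mono[of p "k - d"] that less by (cases "p = k - d") auto
    show ?thesis
    proof (rule weight_less[where m = "b ! (l - d)"])
      \<comment> \<open>Entries of \<open>a\<close> up to position \<open>k - d\<close> have smaller
        \<open>f\<close>; the later ones are entries of \<open>b\<close> to the right of
        \<open>l - d\<close> and have larger \<open>f\<close>.\<close>
      have "b ! (l - d) \<notin> A"
      proof
        assume "b ! (l - d) \<in> A"
        then obtain p where p: "p \<le> k" "b ! (l - d) = a ! p"
          using a(1) len by (metis in_set_conv_nth less_Suc_eq_le)
        show False
        proof (cases "p \<le> k - d")
          case True
          thus ?thesis using low[of p] p by simp
        next
          case False
          have "f (b ! (l - d)) < f (b ! (l - (k - p)))"
            using False p d by (intro b_mono) auto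
          thus ?thesis using eq[of p] False p by simp
        qed
      qed
      moreover have "b ! (l - d) \<in> B"
        using b(1) len by (metis diff_le_self le_imp_less_Suc nth_mem)
      ultimately show "b ! (l - d) \<in> B - A" by simp
    next
      fix x assume x: "x \<in> A - B"
      then obtain p where p: "p \<le> k" "x = a ! p"
        using a(1) len by (metis DiffD1 in_set_conv_nth less_Suc_eq_le)
      \<comment> \<open>An entry of \<open>a\<close> beyond \<open>k - d\<close> belongs to the
        common suffix and so to \<open>B\<close>.\<close>
      have "b ! (l - (k - p)) \<in> B"
        using b(1) len by (metis diff_le_self le_imp_less_Suc nth_mem)
      hence "p \<le> k - d" using eq[of p] p x by force
      thus "f x < f (b ! (l - d))" using low p by simp
    qed (use assms in auto)
  qed
qed

section \<open>Restriction of vector fields\<close>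

text \<open>Curried form of the definition, free of pair patterns under bounded quantifiers, for
  first-order proof search.\<close>

lemma discrete_vf_iff:
  "discrete_vf K F \<longleftrightarrow>
     (\<forall>\<alpha> \<beta>. (\<alpha>, \<beta>) \<in> F \<longrightarrow> \<alpha> \<in> K \<and> \<beta> \<in> K \<and> \<alpha> \<subset> \<beta> \<and> simplex_dim \<beta> = simplex_dim \<alpha> + 1) \<and>
     (\<forall>\<alpha> \<beta>. (\<alpha>, \<beta>) \<in> F \<longrightarrow> (\<forall>\<alpha>' \<beta>'. (\<alpha>', \<beta>') \<in> F \<longrightarrow>
        {\<alpha>, \<beta>} \<inter> {\<alpha>', \<beta>'} \<noteq> {} \<longrightarrow> (\<alpha>, \<beta>) = (\<alpha>', \<beta>')))"
  unfolding discrete_vf_def Ball_def split_paired_All prod.case by (rule refl)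

text \<open>A path of the restriction is also a path of \<open>F\<close>, so a closed one would
  already exist in \<open>K\<close>.\<close>

lemma acyclic_vf_restrict:
  assumes "acyclic_vf K F" "L \<subseteq> K"
  shows "acyclic_vf L (restrict_vf F L)"
proof -
  have "discrete_vf K F" using assms(1) by (simp add: acyclic_vf_def)
  hence "discrete_vf L (restrict_vf F L)"
    unfolding discrete_vf_iff restrict_vf_def mem_Collect_eq prod.case by meson
  moreover have "nontrivial_path K F r \<alpha> \<beta>" if "nontrivial_path L (restrict_vf F L) r \<alpha> \<beta>" for r \<alpha> \<beta>
    using that assms(2) unfolding nontrivial_path_def restrict_vf_def by blast
  ultimately show ?thesis
    using assms(1) unfolding acyclic_vf_def by blast
qed

section \<open>The colex vector field\<close>

locale ordered_complex =
  fixes V :: "'a set" and K :: "'a set set" and f :: "'a \<Rightarrow> nat"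
  assumes cpx: "simplicial_complex V K" and inj: "inj_on f V"
begin

lemma simplexD:
  assumes "\<alpha> \<in> K"
  shows "finite \<alpha>" "\<alpha> \<noteq> {}" "\<alpha> \<subseteq> V" "inj_on f \<alpha>"
  using assms cpx inj unfolding simplicial_complex_def by (auto intro: inj_on_subset)

lemma face_closed: "\<alpha> \<in> K \<Longrightarrow> \<tau> \<noteq> {} \<Longrightarrow> \<tau> \<subseteq> \<alpha> \<Longrightarrow> \<tau> \<in> K"
  using cpx unfolding simplicial_complex_def by blast

lemma candidate_le:
  assumes "v \<in> V" "insert v \<alpha> \<in> K"
  shows "f (candidate V K f \<alpha>) \<le> f v"
  unfolding candidate_def arg_min_on_def
  by (rule arg_min_nat_le) (use assms in \<open>simp add: joinable_def\<close>)

text \<open>The vertices of \<alpha> are joinable to it, since inserting one gives \<alpha> back. So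
  minimality puts \<open>c\<close> below all of them, strictly because \<open>c\<close> is not in
  \<alpha> and \<open>f\<close> is injective.\<close>

lemma arrowE:
  assumes "(\<alpha>, \<beta>) \<in> colex_vf V K f"
  obtains c where "c = candidate V K f \<alpha>" "\<alpha> \<in> K" "\<beta> \<in> K" "\<beta> = insert c \<alpha>" "c \<notin> \<alpha>" "c \<in> V"
    "\<And>v. v \<in> \<alpha> \<Longrightarrow> f c < f v" "\<And>v. insert v \<alpha> \<in> K \<Longrightarrow> f c \<le> f v"
proof -
  define c where "c = candidate V K f \<alpha>"
  have *: "\<alpha> \<in> K" "\<beta> \<in> K" "\<beta> = insert c \<alpha>" "c \<notin> \<alpha>"
    using assms by (auto simp: colex_vf_def c_def)
  have cV: "c \<in> V" using simplexD(3)[OF *(2)] *(3) by auto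
  have le: "f c \<le> f v" if "insert v \<alpha> \<in> K" for v
    using candidate_le[of v \<alpha>] simplexD(3)[OF that] that by (simp add: c_def)
  have "f c < f v" if "v \<in> \<alpha>" for v
  proof -
    have "v \<in> V" using that simplexD(3)[OF *(1)] by auto
    hence "f c \<noteq> f v" using inj cV *(4) that by (metis inj_onD)
    thus ?thesis using le[of v] that *(1) by (simp add: insert_absorb)
  qed
  thus thesis using that c_def * cV le by blast
qed

text \<open>The added vertex is the \<open>f\<close>-least vertex of the head, so the head
  determines it.\<close>

lemma arrow_tail_unique:
  assumes "(\<alpha>, \<beta>) \<in> colex_vf V K f" "(\<alpha>', \<beta>) \<in> colex_vf V K f"
  shows "\<alpha> = \<alpha>'"
proof -
  obtain c where c: "\<beta> = insert c \<alpha>" "c \<notin> \<alpha>" "\<And>v. v \<in> \<alpha> \<Longrightarrow> f c < f v"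
    using assms(1) by (blast elim: arrowE)
  obtain c' where c': "\<beta> = insert c' \<alpha>'" "c' \<notin> \<alpha>'" "\<And>v. v \<in> \<alpha>' \<Longrightarrow> f c' < f v"
    using assms(2) by (blast elim: arrowE)
  have "c = c'" using c c' by (metis insertE insertI1 less_asym)
  thus ?thesis using c c' by (metis insert_ident)
qed

text \<open>If \<open>\<beta>\<close> were also a tail, its candidate would be joinable to \<open>\<alpha>\<close> and smaller than \<open>c\<close>.\<close>

lemma head_not_tail:
  assumes "(\<alpha>, \<beta>) \<in> colex_vf V K f" "(\<beta>, \<gamma>) \<in> colex_vf V K f"
  shows False
proof -
  obtain c where c: "\<beta> = insert c \<alpha>" "\<And>v. insert v \<alpha> \<in> K \<Longrightarrow> f c \<le> f v"
    using assms(1) by (blast elim: arrowE)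
  obtain d where d: "\<gamma> = insert d \<beta>" "\<gamma> \<in> K" "\<And>v. v \<in> \<beta> \<Longrightarrow> f d < f v"
    using assms(2) by (blast elim: arrowE)
  have "insert d \<alpha> \<in> K" using face_closed[OF d(2), of "insert d \<alpha>"] c(1) d(1) by auto
  thus False using c d(3)[of c] by fastforce
qed

lemma discrete_vf_colex: "discrete_vf K (colex_vf V K f)"
proof -
  have head_unique: "\<beta> = \<beta>'" if "(\<alpha>, \<beta>) \<in> colex_vf V K f" "(\<alpha>, \<beta>') \<in> colex_vf V K f" for \<alpha> \<beta> \<beta>'
    using that by (auto simp: colex_vf_def)
  have face: "\<alpha> \<in> K \<and> \<beta> \<in> K \<and> \<alpha> \<subset> \<beta> \<and> simplex_dim \<beta> = simplex_dim \<alpha> + 1"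
    if "(\<alpha>, \<beta>) \<in> colex_vf V K f" for \<alpha> \<beta>
    using that by (auto simp: colex_vf_def)
  have disjoint: "\<alpha> = \<alpha>' \<and> \<beta> = \<beta>'"
    if "(\<alpha>, \<beta>) \<in> colex_vf V K f" "(\<alpha>', \<beta>') \<in> colex_vf V K f" "{\<alpha>, \<beta>} \<inter> {\<alpha>', \<beta>'} \<noteq> {}"
    for \<alpha> \<beta> \<alpha>' \<beta>'
  proof -
    \<comment> \<open>A common tail has one candidate, a common head has one tail, and the head of
      one arrow cannot be the tail of another.\<close>
    from that(3) consider "\<alpha> = \<alpha>'" | "\<beta> = \<beta>'" | "\<alpha> = \<beta>'" | "\<beta> = \<alpha>'" by auto
    thus ?thesis
    proof cases
      case 1
      thus ?thesis using that(1,2) head_unique by simp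
    next
      case 2
      thus ?thesis using that(1,2) arrow_tail_unique by simp
    qed (use that(1,2) head_not_tail in blast)+
  qed
  show ?thesis
    unfolding discrete_vf_iff prod.inject using face disjoint by meson
qed

section \<open>Acyclicity of the colex vector field\<close>

text \<open>Inside \<open>insert c \<alpha>\<close>, \<gamma> has as many vertices as \<alpha>, so
  it misses some \<open>v\<close> of \<alpha> and gains at most \<open>c\<close>, where
  \<open>f c < f v\<close>.\<close>

lemma path_weight_decreasing:
  assumes "(\<alpha>, \<beta>) \<in> colex_vf V K f" "\<gamma> \<in> K" "\<gamma> \<subset> \<beta>" "\<gamma> \<noteq> \<alpha>" "simplex_dim \<gamma> = simplex_dim \<alpha>"
  shows "weight f \<gamma> < weight f \<alpha>"
proof -
  obtain c where c: "\<alpha> \<in> K" "\<beta> = insert c \<alpha>" "\<And>v. v \<in> \<alpha> \<Longrightarrow> f c < f v"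
    using assms(1) by (blast elim: arrowE)
  \<comment> \<open>The dimension is a truncated predecessor, so nonemptiness is what turns equal
    dimensions into equal cardinalities.\<close>
  have "card \<gamma> > 0" "card \<alpha> > 0"
    using simplexD[OF assms(2)] simplexD[OF c(1)] by (auto simp: card_gt_0_iff)
  hence "card \<gamma> = card \<alpha>" using assms(5) by (simp add: simplex_dim_def)
  hence "\<not> \<alpha> \<subseteq> \<gamma>"
    using card_subset_eq[OF simplexD(1)[OF assms(2)], of \<alpha>] assms(4) by auto
  then obtain v where v: "v \<in> \<alpha> - \<gamma>" by auto
  show ?thesis
  proof (rule weight_less[where m = v])
    show "f x < f v" if "x \<in> \<gamma> - \<alpha>" for x
      using that assms(3) c v by auto
  qed (use v simplexD assms(2) c(1) in auto)
qed

lemma acyclic_vf_colex: "acyclic_vf K (colex_vf V K f)"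
proof -
  have False if p: "nontrivial_path K (colex_vf V K f) r \<alpha> \<beta>" and closed: "\<alpha> 0 = \<alpha> (r + 1)" for r \<alpha> \<beta>
  proof -
    have step: "weight f (\<alpha> (Suc i)) < weight f (\<alpha> i)" if i: "i \<le> r" for i
    proof (rule path_weight_decreasing)
      show "(\<alpha> i, \<beta> i) \<in> colex_vf V K f" "\<alpha> (Suc i) \<subset> \<beta> i" "\<alpha> (Suc i) \<noteq> \<alpha> i"
        using p i unfolding nontrivial_path_def by auto
      show "\<alpha> (Suc i) \<in> K" "simplex_dim (\<alpha> (Suc i)) = simplex_dim (\<alpha> i)"
        using p i unfolding nontrivial_path_def by auto
    qed
    have "weight f (\<alpha> (Suc i)) < weight f (\<alpha> 0)" if "i \<le> r" for i
      using that
    proof (induction i)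
      case (Suc i)
      thus ?case using step[of "Suc i"] by simp
    qed (use step in simp)
    from this[of r] closed show False by simp
  qed
  thus ?thesis unfolding acyclic_vf_def using discrete_vf_colex by blast
qed

section \<open>Tails and heads in the weight order\<close>

lemma tail_weight_less_head:
  assumes "(\<alpha>, \<beta>) \<in> colex_vf V K f"
  shows "weight f \<alpha> < weight f \<beta>"
proof -
  obtain c where "\<beta> \<in> K" "\<beta> = insert c \<alpha>" "c \<notin> \<alpha>"
    using assms by (blast elim: arrowE)
  thus ?thesis using simplexD(1)[of \<beta>] by (intro weight_psubset) auto
qed

text \<open>Compare \<open>c\<close> with the largest vertex \<open>m\<close> in which \<open>\<gamma>\<close> and \<open>\<alpha>\<close> differ.\<close>

lemma arrow_consecutive:
  assumes "(\<alpha>, \<beta>) \<in> colex_vf V K f" "\<gamma> \<in> K" "weight f \<alpha> < weight f \<gamma>"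
  shows "weight f \<beta> \<le> weight f \<gamma>"
proof -
  obtain c where c: "\<alpha> \<in> K" "\<beta> \<in> K" "\<beta> = insert c \<alpha>" "c \<in> V" "\<And>v. v \<in> \<alpha> \<Longrightarrow> f c < f v"
      "\<And>v. insert v \<alpha> \<in> K \<Longrightarrow> f c \<le> f v"
    using assms(1) by (blast elim: arrowE)
  note \<alpha> = simplexD[OF c(1)] and \<beta> = simplexD[OF c(2)] and \<gamma> = simplexD[OF assms(2)]
  define S where "S = (\<alpha> - \<gamma>) \<union> (\<gamma> - \<alpha>)"
  have S: "finite S" "S \<noteq> {}" "S \<subseteq> V" using \<alpha> \<gamma> assms(3) by (auto simp: S_def)
  have "Max (f ` S) \<in> f ` S" using S by (intro Max_in) auto
  then obtain m where m: "m \<in> S" "f m = Max (f ` S)" by auto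
  have below: "f x < f m" if "x \<in> S" "x \<noteq> m" for x
  proof -
    have "f x \<le> f m" using that S m by simp
    moreover have "f x \<noteq> f m" using inj that m(1) S(3) by (metis inj_onD subsetD)
    ultimately show ?thesis by simp
  qed
  \<comment> \<open>Otherwise \<open>m\<close> would lie in \<open>\<alpha> - \<gamma>\<close> and
    make \<gamma> the lighter simplex.\<close>
  have "m \<in> \<gamma> - \<alpha>"
  proof (rule ccontr)
    assume "m \<notin> \<gamma> - \<alpha>"
    hence "m \<in> \<alpha> - \<gamma>" using m(1) by (auto simp: S_def)
    hence "weight f \<gamma> < weight f \<alpha>"
      using \<alpha> \<gamma> below by (intro weight_less[of _ _ _ m]) (auto simp: S_def)
    thus False using assms(3) by simp
  qed
  consider "f m < f c" | "m = c" | "f c < f m"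
    using inj c(4) m(1) S(3) by (metis inj_onD linorder_neqE_nat subsetD)
  thus ?thesis
  proof cases
    case 1
    \<comment> \<open>All of \<alpha> lies above \<open>c\<close>, hence above \<open>m\<close>,
      where \<alpha> and \<gamma> agree. Then \<open>m\<close> is joinable to \<alpha> and beats
      \<open>c\<close>, a contradiction.\<close>
    hence "\<alpha> \<subseteq> \<gamma>" using below c(5) unfolding S_def by force
    hence "insert m \<alpha> \<in> K" using face_closed[OF assms(2)] \<open>m \<in> \<gamma> - \<alpha>\<close> by auto
    thus ?thesis using c(6) 1 by fastforce
  next
    case 2
    \<comment> \<open>As in the previous case, and now \<gamma> also contains \<open>c\<close>, so
      \<beta> is a face of \<gamma>.\<close>
    hence "\<alpha> \<subseteq> \<gamma>" using below c(5) unfolding S_def by force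
    thus ?thesis using 2 \<open>m \<in> \<gamma> - \<alpha>\<close> c(3) \<gamma>(1) by (intro weight_subset_mono) auto
  next
    case 3
    \<comment> \<open>Here \<open>m\<close> dominates \<open>\<alpha> - \<gamma>\<close> and also
      \<open>c\<close>, the one vertex that \<beta> adds.\<close>
    have "weight f \<beta> < weight f \<gamma>"
    proof (rule weight_less[where m = m])
      show "m \<in> \<gamma> - \<beta>" using 3 \<open>m \<in> \<gamma> - \<alpha>\<close> c(3) by auto
      show "f x < f m" if "x \<in> \<beta> - \<gamma>" for x
        using that 3 below[of x] \<open>m \<in> \<gamma> - \<alpha>\<close> c(3) by (auto simp: S_def)
    qed (use \<beta> \<gamma> in auto)
    thus ?thesis by simp
  qed
qed

section \<open>Prefixes of the colex listing\<close>

lemma colex_listing_weight_mono: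
  assumes "colex_listing f K N \<sigma>"
  shows "strict_mono_on {1..N} (\<lambda>i. weight f (\<sigma> i))"
proof (rule strict_mono_onI)
  fix i j assume ij: "i \<in> {1..N}" "j \<in> {1..N}" "i < j"
  hence "colex_less f (\<sigma> i) (\<sigma> j)" "\<sigma> i \<in> K" "\<sigma> j \<in> K"
    using assms by (auto simp: colex_listing_def bij_betw_def)
  thus "weight f (\<sigma> i) < weight f (\<sigma> j)"
    by (intro colex_less_imp_weight_less simplexD)
qed

text \<open>A face weighs no more than its simplex, so it is listed no later.\<close>

lemma colex_prefix_complex:
  assumes "colex_listing f K N \<sigma>" "i \<le> N"
  shows "simplicial_complex V (\<sigma> ` {1..i})"
proof -
  have img: "\<sigma> ` {1..N} = K" using assms(1) by (auto simp: colex_listing_def bij_betw_def)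
  have faces: "\<tau> \<in> \<sigma> ` {1..i}" if k: "k \<in> {1..i}" and \<tau>: "\<tau> \<noteq> {}" "\<tau> \<subseteq> \<sigma> k" for k \<tau>
  proof -
    have kK: "\<sigma> k \<in> K" using k assms(2) img by auto
    hence "\<tau> \<in> K" using face_closed \<tau> by blast
    then obtain l where l: "l \<in> {1..N}" "\<tau> = \<sigma> l" using img by auto
    have "weight f (\<sigma> l) \<le> weight f (\<sigma> k)"
      using weight_subset_mono simplexD(1)[OF kK] \<tau>(2) l(2) by blast
    hence "l \<le> k"
      using strict_mono_onD[OF colex_listing_weight_mono[OF assms(1)], of k l] k l(1) assms(2)
      by fastforce
    thus ?thesis using l k by auto
  qed
  have "\<sigma> ` {1..i} \<subseteq> K" using img assms(2) by fastforce
  thus ?thesis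
    unfolding simplicial_complex_def by (blast dest: simplexD intro: faces)
qed

lemma arrow_indices:
  assumes "colex_listing f K N \<sigma>" "(\<alpha>, \<beta>) \<in> colex_vf V K f"
  obtains i where "i \<in> {1..N - 1}" "\<alpha> = \<sigma> i" "\<beta> = \<sigma> (i + 1)"
proof -
  have img: "\<sigma> ` {1..N} = K" using assms(1) by (auto simp: colex_listing_def bij_betw_def)
  note mono = strict_mono_onD[OF colex_listing_weight_mono[OF assms(1)]]
  have "\<alpha> \<in> K" "\<beta> \<in> K" using assms(2) by (auto simp: colex_vf_def)
  then obtain i l where il: "i \<in> {1..N}" "\<alpha> = \<sigma> i" "l \<in> {1..N}" "\<beta> = \<sigma> l" using img by auto
  have less: "weight f (\<sigma> i) < weight f (\<sigma> l)" using tail_weight_less_head[OF assms(2)] il by simp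
  have "i < l" using mono[of l i] less il by (cases i l rule: linorder_cases) auto
  \<comment> \<open>A simplex listed strictly between tail and head would contradict
    \<open>arrow_consecutive\<close>.\<close>
  have "\<not> i + 1 < l"
  proof
    assume gap: "i + 1 < l"
    hence mem: "i + 1 \<in> {1..N}" using il by auto
    have "weight f \<beta> \<le> weight f (\<sigma> (i + 1))"
      using mono[of i "i + 1"] mem il img by (intro arrow_consecutive[OF assms(2)]) auto
    thus False using mono[of "i + 1" l] gap mem il by auto
  qed
  hence "l = i + 1" using \<open>i < l\<close> by simp
  thus thesis using that[of i] il by auto
qed

text \<open>The arrow occupies indices \<open>k\<close> and \<open>k + 1\<close>, so a prefix of
  length \<open>i\<close> separates them only for \<open>k = i\<close>, that is, for a tail index
  \<open>i\<close>.\<close>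

lemma prefix_tail_iff_head:
  assumes "colex_listing f K N \<sigma>" "(\<alpha>, \<beta>) \<in> colex_vf V K f"
    and "i \<le> N" "i \<notin> {i \<in> {1..N - 1}. (\<sigma> i, \<sigma> (i + 1)) \<in> colex_vf V K f}"
  shows "\<alpha> \<in> \<sigma> ` {1..i} \<longleftrightarrow> \<beta> \<in> \<sigma> ` {1..i}"
proof -
  obtain k where k: "k \<in> {1..N - 1}" "\<alpha> = \<sigma> k" "\<beta> = \<sigma> (k + 1)"
    using assms(1,2) by (rule arrow_indices)
  have inj\<sigma>: "inj_on \<sigma> {1..N}" using assms(1) by (auto simp: colex_listing_def bij_betw_def)
  have mem: "\<sigma> l \<in> \<sigma> ` {1..i} \<longleftrightarrow> l \<le> i" if "l \<in> {1..N}" for l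
    using inj_on_image_mem_iff[OF inj\<sigma> that, of "{1..i}"] assms(3) that by auto
  have "k \<noteq> i" using assms(2,4) k by auto
  hence "k \<le> i \<longleftrightarrow> k + 1 \<le> i" by auto
  moreover have "k \<in> {1..N}" "k + 1 \<in> {1..N}" using k(1) by auto
  ultimately show ?thesis unfolding k(2,3) by (simp only: mem)
qed

end

text \<open>An arrow meeting \<open>L\<close> lies wholly in \<open>L\<close>, so enlarging the
  frame creates no new arrow at \<sigma>. Criticality needs the converse directions for tails and
  heads: lying in no arrow has to persist.\<close>

lemma restrict_vf_tail_head_critical:
  assumes "\<And>\<alpha> \<beta>. (\<alpha>, \<beta>) \<in> F \<Longrightarrow> \<alpha> \<in> L \<longleftrightarrow> \<beta> \<in> L" "L \<subseteq> L'" "\<sigma> \<in> L"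
  shows "is_tail (restrict_vf F L) \<sigma> \<longleftrightarrow> is_tail (restrict_vf F L') \<sigma>"
    and "is_head (restrict_vf F L) \<sigma> \<longleftrightarrow> is_head (restrict_vf F L') \<sigma>"
    and "is_critical L (restrict_vf F L) \<sigma> \<longleftrightarrow> is_critical L' (restrict_vf F L') \<sigma>"
proof -
  show tail: "is_tail (restrict_vf F L) \<sigma> \<longleftrightarrow> is_tail (restrict_vf F L') \<sigma>"
    and head: "is_head (restrict_vf F L) \<sigma> \<longleftrightarrow> is_head (restrict_vf F L') \<sigma>"
    using assms unfolding is_tail_def is_head_def restrict_vf_def by blast+
  show "is_critical L (restrict_vf F L) \<sigma> \<longleftrightarrow> is_critical L' (restrict_vf F L') \<sigma>"
    using assms(2,3) tail head unfolding is_critical_def by blast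
qed

section \<open>The filtration by non-tail indices\<close>

theorem proposition3p7:
  fixes V :: "'a set" and K :: "'a set set" and f :: "'a \<Rightarrow> nat" and n N :: nat
    and \<sigma> :: "nat \<Rightarrow> 'a set" and Kf :: "nat \<Rightarrow> 'a set set" and T J :: "nat set"
    and j :: "nat \<Rightarrow> nat"
  assumes "finite V" and "card V = n"
    and "simplicial_complex V K"
    and "bij_betw f V {1..n}"
    and "colex_listing f K N \<sigma>"
    and "\<And>i. Kf i = \<sigma> ` {1..i}"
    and "T = {i \<in> {1..N - 1}. (\<sigma> i, \<sigma> (i + 1)) \<in> colex_vf V K f}"
    and "J = {1..N} - T"
    and "j 0 = 0"
    and "bij_betw j {1..N - card T} J"
    and "strict_mono_on {1..N - card T} j"
  shows "filtered_acyclic_vf V K (N - card T) (\<lambda>m. Kf (j m))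
           (\<lambda>m. restrict_vf (colex_vf V K f) (Kf (j m)))"
proof -
  let ?F = "colex_vf V K f" and ?M = "N - card T"
  let ?R = "\<lambda>m. restrict_vf ?F (Kf (j m))"
  interpret ordered_complex V K f
    using assms(3,4) by unfold_locales (auto simp: bij_betw_def)
  have img: "\<sigma> ` {1..N} = K" and inj\<sigma>: "inj_on \<sigma> {1..N}"
    using assms(5) by (auto simp: colex_listing_def bij_betw_def)
  have jimg: "j ` {1..?M} = J" using assms(10) by (auto simp: bij_betw_def)
  have jJ: "j m \<in> J" if "m \<in> {1..?M}" for m using jimg that by auto
  have jN: "j m \<le> N" if "m \<le> ?M" for m
    using jJ[of m] that assms(8,9) by (cases "m = 0") auto
  \<comment> \<open>Index 0 lies outside the range of monotonicity; the first step uses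
    \<open>j 0 = 0\<close> and \<open>J \<subseteq> {1..N}\<close>.\<close>
  have jless: "j m < j (m + 1)" if "m < ?M" for m
  proof (cases "m = 0")
    case True
    thus ?thesis using jJ[of 1] that assms(8,9) by auto
  next
    case False
    thus ?thesis using strict_mono_onD[OF assms(11), of m "m + 1"] that by auto
  qed
  have jM: "j ?M = N"
  proof (cases "N = 0")
    case True
    thus ?thesis using assms(9) by simp
  next
    case False
    \<comment> \<open>\<open>T\<close> stops at \<open>N - 1\<close>, so \<open>N\<close> is a
      non-tail index, and monotonicity places it last.\<close>
    hence "N \<in> J" using assms(7,8) by auto
    then obtain m where m: "m \<in> {1..?M}" "j m = N" using jimg by (metis imageE)
    have "\<not> m < ?M" using strict_mono_onD[OF assms(11), of m ?M] m jN[of ?M] by auto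
    thus ?thesis using m by simp
  qed
  have strict: "Kf (j m) \<subset> Kf (j (m + 1))" if "m < ?M" for m
  proof -
    have "{1..j m} \<subset> {1..j (m + 1)}" using jless[OF that] by auto
    thus ?thesis unfolding assms(6)
      using that jN[of "m + 1"] by (intro image_strict_mono inj_on_subset[OF inj\<sigma>]) auto
  qed
  have sub: "Kf (j m) \<subseteq> K" if "m \<le> ?M" for m
    unfolding assms(6) img[symmetric] using jN[OF that] by (intro image_mono) auto
  have "filtration V K ?M (\<lambda>m. Kf (j m))"
    unfolding filtration_def
    using strict colex_prefix_complex[OF assms(5)] jN jM img by (simp add: assms(6,9))
  moreover have "acyclic_vf (Kf (j m)) (restrict_vf ?F (Kf (j m)))" if "m \<in> {1..?M}" for m
    using that by (intro acyclic_vf_restrict[OF acyclic_vf_colex] sub) simp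
  moreover have "(\<forall>\<tau>\<in>Kf (j m).
        (is_tail (?R m) \<tau> \<longrightarrow> is_tail (?R (m + 1)) \<tau>) \<and>
        (is_head (?R m) \<tau> \<longrightarrow> is_head (?R (m + 1)) \<tau>) \<and>
        (is_critical (Kf (j m)) (?R m) \<tau> \<longrightarrow> is_critical (Kf (j (m + 1))) (?R (m + 1)) \<tau>)) \<and>
      (\<forall>\<alpha> \<beta>. (\<alpha>, \<beta>) \<in> ?R (m + 1) \<and> \<alpha> \<in> Kf (j m) \<and> \<beta> \<in> Kf (j m) \<longrightarrow> (\<alpha>, \<beta>) \<in> ?R m)"
    if m: "m \<in> {1..?M - 1}" for m
  proof -
    have "m < ?M" using m by simp linarith
    hence sub: "Kf (j m) \<subseteq> Kf (j (m + 1))" using strict by blast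
    have "j m \<in> J" using m by (intro jJ) auto
    \<comment> \<open>The choice of frames enters here: a non-tail index cuts no arrow.\<close>
    hence "j m \<le> N" "j m \<notin> T" using assms(8) by auto
    hence "\<And>\<alpha> \<beta>. (\<alpha>, \<beta>) \<in> ?F \<Longrightarrow> \<alpha> \<in> Kf (j m) \<longleftrightarrow> \<beta> \<in> Kf (j m)"
      unfolding assms(6) by (intro prefix_tail_iff_head[OF assms(5)]) (simp_all add: assms(7))
    note same = restrict_vf_tail_head_critical[of ?F, OF this sub]
    have "(\<alpha>, \<beta>) \<in> ?R m"
      if "(\<alpha>, \<beta>) \<in> ?R (m + 1)" "\<alpha> \<in> Kf (j m)" "\<beta> \<in> Kf (j m)" for \<alpha> \<beta>
      using that by (simp add: restrict_vf_def)
    thus ?thesis using same by (intro conjI ballI allI impI) blast+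
  qed
  ultimately show ?thesis
    unfolding filtered_acyclic_vf_def by (rule conjI[OF _ conjI[OF ballI ballI]])
qed

end
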